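(* Let $\gamma$ be a smooth closed plane curve without affine inflexions, parametrized by affine arclength $s$, with affine curvature $\mu$. Then there is a first $\alpha$ for which the condition $$\mu_s(s)=\frac{(1-\alpha)\left((1-\alpha)^2+\mu(s)\alpha^2\right)}{\alpha^3}$$ occurs; that is, there is $\alpha_0\in(0,1]$ such that this condition holds with $\alpha=\alpha_0$ for some $s$, and for every $\alpha\in(0,\alpha_0)$ it holds for no $s$.
   Context: For $u,v\in\mathbb{R}^2$, $[u,v]$ denotes the determinant with columns $u,v$; subscripts denote derivatives. A curve is parametrized by affine arclength $s$ if $[\gamma_s,\gamma_{ss}]=1$ for all $s$; then $\gamma_{sss}=-\mu\gamma_s$, where $\mu=[\gamma_{ss},\gamma_{sss}]$ is the affine curvature. "Closed" means that $\gamma$ is a smooth periodic function of $s$. An affine inflexion is a point where $\mu=0$, so "without affine inflexions" means $\mu$ is nowhere zero. (The displayed condition is the condition for the envelope of the lines through $\gamma(s)$ with direction $(1-\alpha)\gamma_s+\alpha\gamma_{ss}$, the affine evolutoid, to be non-regular at $s$.) *)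

theory Defs
  imports "HOL-Analysis.Analysis"
begin

definition curve_deriv :: "nat \<Rightarrow> (real \<Rightarrow> 'a::real_normed_vector) \<Rightarrow> real \<Rightarrow> 'a" where
  "curve_deriv n \<gamma> = ((\<lambda>f s. vector_derivative f (at s)) ^^ n) \<gamma>"

text \<open>Since \<^const>\<open>vector_derivative\<close> is total, smoothness has to assert differentiability at every order.\<close>

definition smooth_curve :: "(real \<Rightarrow> 'a::real_normed_vector) \<Rightarrow> bool" where
  "smooth_curve \<gamma> \<longleftrightarrow> (\<forall>n s. curve_deriv n \<gamma> differentiable (at s))"

text \<open>A closed curve is a smooth periodic function on the whole line; it need not be simple, and the
  period need not be minimal.\<close>

definition smooth_closed_curve :: "(real \<Rightarrow> 'a::real_normed_vector) \<Rightarrow> bool" where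
  "smooth_closed_curve \<gamma> \<longleftrightarrow> smooth_curve \<gamma> \<and> (\<exists>L>0. \<forall>s. \<gamma> (s + L) = \<gamma> s)"

text \<open>\<^term>\<open>vector [u, v]\<close> has rows \<open>u\<close> and \<open>v\<close>; transposing makes them columns.\<close>

definition det_cols :: "real ^ 2 \<Rightarrow> real ^ 2 \<Rightarrow> real" where
  "det_cols u v = det (transpose (vector [u, v] :: real ^ 2 ^ 2))"

definition affine_arclength_param :: "(real \<Rightarrow> real ^ 2) \<Rightarrow> bool" where
  "affine_arclength_param \<gamma> \<longleftrightarrow> (\<forall>s. det_cols (curve_deriv 1 \<gamma> s) (curve_deriv 2 \<gamma> s) = 1)"

definition affine_curvature :: "(real \<Rightarrow> real ^ 2) \<Rightarrow> real \<Rightarrow> real" where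
  "affine_curvature \<gamma> s = det_cols (curve_deriv 2 \<gamma> s) (curve_deriv 3 \<gamma> s)"

definition affine_inflexion :: "(real \<Rightarrow> real ^ 2) \<Rightarrow> real \<Rightarrow> bool" where
  "affine_inflexion \<gamma> s \<longleftrightarrow> affine_curvature \<gamma> s = 0"

text \<open>The condition for the envelope of the lines through \<open>\<gamma>(s)\<close> with direction
  \<open>(1 - \<alpha>) \<gamma>\<^sub>s + \<alpha> \<gamma>\<^sub>s\<^sub>s\<close> (the affine evolutoid) to be non-regular at \<open>s\<close>: the
  envelope point is \<open>\<gamma>\<close> plus \<open>\<alpha> / ((1 - \<alpha>)^2 + \<mu> \<alpha>^2)\<close> times that direction. Meant for \<open>\<alpha> \<noteq> 0\<close>.\<close>

definition evolutoid_singular_condition :: "(real \<Rightarrow> real ^ 2) \<Rightarrow> real \<Rightarrow> real \<Rightarrow> bool" where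
  "evolutoid_singular_condition \<gamma> \<alpha> s \<longleftrightarrow>
     deriv (affine_curvature \<gamma>) s =
       (1 - \<alpha>) * ((1 - \<alpha>) ^ 2 + affine_curvature \<gamma> s * \<alpha> ^ 2) / \<alpha> ^ 3"

end

theory Submission
  imports Defs
begin

text \<open>
  Multiplying the singularity condition by \<open>\<alpha>\<^sup>3\<close> turns it into
  \<open>\<mu>\<^sub>s \<alpha>\<^sup>3 = (1 - \<alpha>) ((1 - \<alpha>)\<^sup>2 + \<mu> \<alpha>\<^sup>2)\<close>, which is an equivalent condition for \<open>\<alpha> > 0\<close> but
  also makes sense at \<open>\<alpha> = 0\<close>, where it reads \<open>0 = 1\<close> and so fails. The curvature \<open>\<mu>\<close> and
  its derivative are continuous and periodic, so the solutions \<open>(\<alpha>, s)\<close> of the polynomial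
  condition with \<open>\<alpha> \<in> [0, 1]\<close> and \<open>s\<close> in one period form a compact set. At \<open>\<alpha> = 1\<close> the
  condition is \<open>\<mu>\<^sub>s = 0\<close>, which Rolle's theorem provides on a period, so the set
  is nonempty (these points are the sextactic points of the curve). The coordinate \<open>\<alpha>\<close> attains a minimum
  on it, which is positive because there are no solutions at \<open>\<alpha> = 0\<close>: this is the first \<open>\<alpha>\<close>.

  The compactness argument concerns any periodic \<open>C\<^sup>1\<close> function \<open>\<mu>\<close>
  (\<open>periodic_first_singular_parameter\<close>); it applies to the affine curvature because that is a
  bilinear expression in derivatives of \<open>\<gamma>\<close>.
\<close>

lemma periodic_value_in_period:
  fixes f :: "real \<Rightarrow> 'a"
  assumes per: "\<And>s. f (s + L) = f s" and "L > 0"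
  obtains t where "t \<in> {0..L}" "f t = f s"
proof
  interpret periodic_fun_simple f L
    by unfold_locales (rule per)
  have "of_int \<lfloor>s / L\<rfloor> * L \<le> s" "s \<le> (of_int \<lfloor>s / L\<rfloor> + 1) * L"
    unfolding pos_le_divide_eq[OF \<open>L > 0\<close>, symmetric] pos_divide_le_eq[OF \<open>L > 0\<close>, symmetric]
    by linarith+
  then show "s - of_int \<lfloor>s / L\<rfloor> * L \<in> {0..L}"
    by (simp add: algebra_simps)
  show "f (s - of_int \<lfloor>s / L\<rfloor> * L) = f s"
    by (rule minus_of_int)
qed

lemma vector_derivative_periodic:
  fixes f :: "real \<Rightarrow> 'a::real_normed_vector"
  assumes per: "\<And>s. f (s + L) = f s" and diff: "\<And>s. f differentiable (at s)"
  shows "vector_derivative f (at (s + L)) = vector_derivative f (at s)"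
proof -
  have "(f has_vector_derivative vector_derivative f (at (s + L))) (at (s + L))"
    using diff by (simp add: vector_derivative_works)
  then have "((f \<circ> (\<lambda>x. x + L)) has_vector_derivative
      1 *\<^sub>R vector_derivative f (at (s + L))) (at s)"
    by (intro vector_diff_chain_at) (auto intro!: derivative_eq_intros)
  moreover have "f \<circ> (\<lambda>x. x + L) = f"
    by (simp add: fun_eq_iff per)
  ultimately show ?thesis
    by (simp add: vector_derivative_at)
qed

text \<open>
  The first parameter is the minimum of \<open>\<alpha>\<close> over the compact set \<open>K\<close> of solutions of the
  condition cleared of its denominator. Restricting \<open>s\<close> to one period is what makes \<open>K\<close>
  bounded; admitting \<open>\<alpha> = 0\<close> is what makes it closed.
\<close>

lemma periodic_first_singular_parameter:
  fixes \<mu> \<nu> :: "real \<Rightarrow> real"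
  assumes "L > 0" and per: "\<And>s. \<mu> (s + L) = \<mu> s"
    and deriv: "\<And>s. (\<mu> has_real_derivative \<nu> s) (at s)"
    and cont: "continuous_on UNIV \<nu>"
  shows "\<exists>\<alpha>\<^sub>0\<in>{0<..1}. (\<exists>s. \<nu> s = (1 - \<alpha>\<^sub>0) * ((1 - \<alpha>\<^sub>0)\<^sup>2 + \<mu> s * \<alpha>\<^sub>0\<^sup>2) / \<alpha>\<^sub>0 ^ 3) \<and>
    (\<forall>\<alpha>\<in>{0<..<\<alpha>\<^sub>0}. \<forall>s. \<nu> s \<noteq> (1 - \<alpha>) * ((1 - \<alpha>)\<^sup>2 + \<mu> s * \<alpha>\<^sup>2) / \<alpha> ^ 3)"
proof -
  define F where "F = (\<lambda>(\<alpha>, s). \<nu> s * \<alpha> ^ 3 - (1 - \<alpha>) * ((1 - \<alpha>)\<^sup>2 + \<mu> s * \<alpha>\<^sup>2))"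
  define K where "K = {p \<in> {0..1} \<times> {0..L}. F p = 0}"
  have F_iff: "F (\<alpha>, s) = 0 \<longleftrightarrow> \<nu> s = (1 - \<alpha>) * ((1 - \<alpha>)\<^sup>2 + \<mu> s * \<alpha>\<^sup>2) / \<alpha> ^ 3"
    if "\<alpha> > 0" for \<alpha> s
    using that by (simp add: F_def eq_divide_eq)
  have \<mu>_cont: "continuous_on A \<mu>" for A
    by (rule DERIV_continuous_on) (rule has_field_derivative_at_within[OF deriv])
  have \<nu>_per: "\<nu> (s + L) = \<nu> s" for s
  proof -
    have \<nu>_eq: "vector_derivative \<mu> (at x) = \<nu> x" for x
      using deriv
      by (simp add: vector_derivative_at has_real_derivative_iff_has_vector_derivative)
    have "\<mu> differentiable (at x)" for x
      using deriv real_differentiable_def by blast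
    from vector_derivative_periodic[of \<mu> L, OF per this] show ?thesis
      by (simp add: \<nu>_eq)
  qed
  have "continuous_on UNIV F"
    unfolding F_def case_prod_beta
    by (intro continuous_intros continuous_on_compose2[OF cont]
        continuous_on_compose2[OF \<mu>_cont[of UNIV]]) auto
  then have "closed {p. F p = 0}"
    by (intro closed_Collect_eq continuous_intros)
  then have "compact (({0..1} \<times> {0..L}) \<inter> {p. F p = 0})"
    by (intro compact_Int_closed compact_Times compact_Icc)
  moreover have "({0..1} \<times> {0..L}) \<inter> {p. F p = 0} = K"
    by (auto simp: K_def)
  ultimately have "compact K" by simp
  obtain z where "0 < z" "z < L" "(\<mu> has_real_derivative 0) (at z)"
    using Rolle[OF \<open>L > 0\<close>, of \<mu>] per[of 0] \<mu>_cont deriv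
    by (metis add_0 real_differentiable_def)
  then have "(1, z) \<in> K"
    using DERIV_unique[OF deriv[of z]] by (simp add: K_def F_def)
  then have "K \<noteq> {}" by blast
  from continuous_attains_inf[OF \<open>compact K\<close> this continuous_on_fst[OF continuous_on_id]]
  obtain \<alpha>\<^sub>0 s\<^sub>0 where in_K: "(\<alpha>\<^sub>0, s\<^sub>0) \<in> K" and least: "\<And>p. p \<in> K \<Longrightarrow> \<alpha>\<^sub>0 \<le> fst p"
    by force
  have "\<alpha>\<^sub>0 \<noteq> 0"
    using in_K by (auto simp: K_def F_def)
  with in_K have \<alpha>\<^sub>0: "0 < \<alpha>\<^sub>0" "\<alpha>\<^sub>0 \<le> 1" and "F (\<alpha>\<^sub>0, s\<^sub>0) = 0"
    by (auto simp: K_def)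
  moreover have "F (\<alpha>, s) \<noteq> 0" if "\<alpha> \<in> {0<..<\<alpha>\<^sub>0}" for \<alpha> s
  proof
    assume "F (\<alpha>, s) = 0"
    have "F (\<alpha>, x + L) = F (\<alpha>, x)" for x
      by (simp add: F_def per \<nu>_per)
    from periodic_value_in_period[of "\<lambda>x. F (\<alpha>, x)", OF this \<open>L > 0\<close>]
    obtain t where "t \<in> {0..L}" "F (\<alpha>, t) = F (\<alpha>, s)" .
    with \<open>F (\<alpha>, s) = 0\<close> that \<alpha>\<^sub>0 have "(\<alpha>, t) \<in> K"
      by (simp add: K_def)
    from least[OF this] that show False by simp
  qed
  ultimately show ?thesis
    by (intro bexI[of _ \<alpha>\<^sub>0] conjI exI[of _ s\<^sub>0] ballI allI) (simp_all add: F_iff)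
qed

lemma curve_deriv_has_vector_derivative:
  assumes "smooth_curve \<gamma>"
  shows "(curve_deriv n \<gamma> has_vector_derivative curve_deriv (Suc n) \<gamma> s) (at s)"
  using assms by (simp add: smooth_curve_def curve_deriv_def vector_derivative_works)

lemma curve_deriv_periodic:
  assumes "smooth_curve \<gamma>" and "\<And>s. \<gamma> (s + L) = \<gamma> s"
  shows "curve_deriv n \<gamma> (s + L) = curve_deriv n \<gamma> s"
proof (induction n arbitrary: s)
  case 0
  show ?case by (simp add: curve_deriv_def assms)
next
  case (Suc n)
  have "curve_deriv n \<gamma> differentiable (at x)" for x
    using assms(1) by (simp add: smooth_curve_def)
  from vector_derivative_periodic[OF Suc.IH this] show ?case
    by (simp add: curve_deriv_def)
qed

lemma det_cols_eq: "det_cols u v = u $ 1 * v $ 2 - v $ 1 * u $ 2"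
  by (simp add: det_cols_def det_2 transpose_def)

text \<open>
  The product rule gives \<open>[\<gamma>\<^sub>s\<^sub>s\<^sub>s, \<gamma>\<^sub>s\<^sub>s\<^sub>s] + [\<gamma>\<^sub>s\<^sub>s, \<gamma>\<^sub>s\<^sub>s\<^sub>s\<^sub>s]\<close>, whose first summand vanishes.
\<close>

lemma affine_curvature_has_real_derivative:
  assumes "smooth_curve \<gamma>"
  shows "(affine_curvature \<gamma> has_real_derivative
    det_cols (curve_deriv 2 \<gamma> s) (curve_deriv 4 \<gamma> s)) (at s)"
proof -
  have comp: "((\<lambda>x. curve_deriv n \<gamma> x $ i) has_real_derivative curve_deriv (Suc n) \<gamma> s $ i) (at s)"
    for n i
    unfolding has_real_derivative_iff_has_vector_derivative
    by (rule bounded_linear.has_vector_derivative[OF bounded_linear_vec_nth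
          curve_deriv_has_vector_derivative[OF assms]])
  note comp2 = comp[of 2, simplified] and comp3 = comp[of 3, simplified]
  show ?thesis
    unfolding affine_curvature_def det_cols_eq
    by (rule derivative_eq_intros comp2 comp3 refl)+ (simp add: eval_nat_numeral)
qed

theorem theorem2:
  fixes \<gamma> :: "real \<Rightarrow> real ^ 2"
  assumes "smooth_closed_curve \<gamma>"
    and "affine_arclength_param \<gamma>"
    and "\<And>s. \<not> affine_inflexion \<gamma> s"
  shows "\<exists>\<alpha>\<^sub>0\<in>{0<..1}. (\<exists>s. evolutoid_singular_condition \<gamma> \<alpha>\<^sub>0 s) \<and>
           (\<forall>\<alpha>\<in>{0<..<\<alpha>\<^sub>0}. \<forall>s. \<not> evolutoid_singular_condition \<gamma> \<alpha> s)"
proof -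
  from assms(1) obtain L where smooth: "smooth_curve \<gamma>" and "L > 0"
    and per: "\<And>s. \<gamma> (s + L) = \<gamma> s"
    by (auto simp: smooth_closed_curve_def)
  define \<nu> where "\<nu> s = det_cols (curve_deriv 2 \<gamma> s) (curve_deriv 4 \<gamma> s)" for s
  have deriv: "(affine_curvature \<gamma> has_real_derivative \<nu> s) (at s)" for s
    unfolding \<nu>_def by (rule affine_curvature_has_real_derivative[OF smooth])
  have "continuous_on UNIV (curve_deriv n \<gamma>)" for n
    using smooth
    by (simp add: smooth_curve_def continuous_at_imp_continuous_on
        differentiable_imp_continuous_within)
  then have "continuous_on UNIV \<nu>"
    unfolding \<nu>_def det_cols_eq by (intro continuous_intros)
  moreover have "affine_curvature \<gamma> (s + L) = affine_curvature \<gamma> s" for s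
    by (simp add: affine_curvature_def curve_deriv_periodic[OF smooth per])
  ultimately show ?thesis
    using periodic_first_singular_parameter[OF \<open>L > 0\<close> _ deriv]
    by (simp add: evolutoid_singular_condition_def DERIV_imp_deriv[OF deriv])
qed

end
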